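(* Let $X$ be an infinite connected Hausdorff space. Then $\mathcal{O}_{cs}(X)\subseteq \mathrm{end}(X)$; that is, for every continuous selection $f:\mathcal{F}(X)\to X$, the point $f(X)$ is an endpoint of $X$.
   Context: For a Hausdorff space $X$, $\mathcal{F}(X)$ denotes the set of all nonempty closed subsets of $X$, endowed with the Vietoris topology, which is generated by all sets of the form $\langle\mathcal{V}\rangle=\{S\in\mathcal{F}(X): S\subseteq\bigcup\mathcal{V}\text{ and } S\cap V\neq\emptyset\text{ for all }V\in\mathcal{V}\}$, where $\mathcal{V}$ runs over the finite families of open subsets of $X$. A selection for $\mathcal{F}(X)$ is a map $f:\mathcal{F}(X)\to X$ with $f(S)\in S$ for every $S\in\mathcal{F}(X)$; it is continuous if it is continuous with respect to the Vietoris topology. Set $\mathcal{O}_{cs}(X)=\{f(X): f \text{ is a continuous selection for } \mathcal{F}(X)\}\subseteq X$ (this is empty if there are no continuous selections). The order $\mathrm{ord}(p,X)$ of a point $p\in X$ is the least cardinal $\lambda$ such that every open set $U\subseteq X$ with $p\in U$ contains an open set $V\subseteq X$ with $p\in V$ and $|\partial V|\leq\lambda$, where $\partial V$ is the boundary of $V$. For a connected space $X$, a point $p\in X$ is an endpoint if $\mathrm{ord}(p,X)=1$, and $\mathrm{end}(X)$ denotes the set of all endpoints of $X$. *)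

theory Defs
  imports "HOL-Analysis.Analysis"
begin

unbundle cardinal_syntax

definition hyperspace :: "'a topology \<Rightarrow> 'a set set" where
  "hyperspace X = {S. closedin X S \<and> S \<noteq> {}}"

definition vietoris_basic :: "'a topology \<Rightarrow> 'a set set \<Rightarrow> 'a set set" where
  "vietoris_basic X \<V> = {S \<in> hyperspace X. S \<subseteq> \<Union>\<V> \<and> (\<forall>V\<in>\<V>. S \<inter> V \<noteq> {})}"

definition vietoris :: "'a topology \<Rightarrow> 'a set topology" where
  "vietoris X =
     topology_generated_by {vietoris_basic X \<V> |\<V>. finite \<V> \<and> (\<forall>V\<in>\<V>. openin X V)}"

lemma topspace_vietoris: "topspace (vietoris X) = hyperspace X"
proof -
  have "hyperspace X \<subseteq> vietoris_basic X {topspace X}"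
    by (auto simp: hyperspace_def vietoris_basic_def dest: closedin_subset)
  moreover have "vietoris_basic X {topspace X}
      \<in> {vietoris_basic X \<V> |\<V>. finite \<V> \<and> (\<forall>V\<in>\<V>. openin X V)}"
    by (intro CollectI exI[of _ "{topspace X}"]) auto
  ultimately have "hyperspace X
      \<subseteq> \<Union>{vietoris_basic X \<V> |\<V>. finite \<V> \<and> (\<forall>V\<in>\<V>. openin X V)}"
    by blast
  then show ?thesis
    unfolding vietoris_def topology_generated_by_topspace
    by (intro equalityI) (auto simp: vietoris_basic_def)
qed

definition selection :: "'a topology \<Rightarrow> ('a set \<Rightarrow> 'a) \<Rightarrow> bool" where
  "selection X f \<longleftrightarrow> (\<forall>S\<in>hyperspace X. f S \<in> S)"

definition continuous_selection :: "'a topology \<Rightarrow> ('a set \<Rightarrow> 'a) \<Rightarrow> bool" where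
  "continuous_selection X f \<longleftrightarrow> selection X f \<and> continuous_map (vietoris X) X f"

definition O_cs :: "'a topology \<Rightarrow> 'a set" where
  "O_cs X = {f (topspace X) |f. continuous_selection X f}"

definition order_bound :: "'a \<Rightarrow> 'a topology \<Rightarrow> 'a rel \<Rightarrow> bool" where
  "order_bound p X r \<longleftrightarrow>
     (\<forall>U. openin X U \<and> p \<in> U \<longrightarrow>
       (\<exists>V. openin X V \<and> p \<in> V \<and> V \<subseteq> U \<and> |X frontier_of V| \<le>o r))"

text \<open>
  Cardinals are represented by cardinal orders. Those living on \<^typ>\<open>'a\<close> suffice, because every
  boundary is a subset of \<^typ>\<open>'a\<close>. The least one is determined only up to \<^const>\<open>ordIso2\<close>, so
  \<open>point_order\<close> chooses a representative, and values have to be compared with \<^const>\<open>ordIso2\<close>.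
\<close>

definition point_order :: "'a \<Rightarrow> 'a topology \<Rightarrow> 'a rel" where
  "point_order p X =
     (SOME r. Card_order r \<and> order_bound p X r \<and>
        (\<forall>r'. Card_order r' \<and> order_bound p X r' \<longrightarrow> r \<le>o r'))"

lemma point_order_least:
  shows "Card_order (point_order p X)"
    and "order_bound p X (point_order p X)"
    and "\<And>r'. Card_order r' \<Longrightarrow> order_bound p X r' \<Longrightarrow> point_order p X \<le>o r'"
proof -
  let ?R = "{r :: 'a rel. Card_order r \<and> order_bound p X r}"
  have "|UNIV :: 'a set| \<in> ?R"
    unfolding order_bound_def by (auto intro: card_of_mono1 card_of_Card_order)
  then have "\<exists>r\<in>?R. \<forall>r'\<in>?R. r \<le>o r'"
    by (intro exists_minim_Card_order) auto
  then have "\<exists>r. Card_order r \<and> order_bound p X r \<and>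
      (\<forall>r'. Card_order r' \<and> order_bound p X r' \<longrightarrow> r \<le>o r')"
    by auto
  from someI_ex[OF this, folded point_order_def]
  show "Card_order (point_order p X)" "order_bound p X (point_order p X)"
    "\<And>r'. Card_order r' \<Longrightarrow> order_bound p X r' \<Longrightarrow> point_order p X \<le>o r'"
    by auto
qed

definition endpoints :: "'a topology \<Rightarrow> 'a set" where
  "endpoints X = {p \<in> topspace X. point_order p X =o BNF_Cardinal_Arithmetic.cone}"

end

theory Submission
  imports Defs
begin

text \<open>
  Say that \<open>x\<close> precedes \<open>y\<close> if \<open>f\<close> selects \<open>x\<close> from \<open>{x, y}\<close>. Since \<open>X\<close> is connected, this is a linear
  order with open rays, and on every finite set \<open>f\<close> selects the minimum: move one point at a time
  inside a connected closed ray that avoids the minimum. Continuity at \<open>X\<close> gives, for every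
  neighbourhood \<open>U\<close> of \<open>p = f X\<close>, a finite set \<open>F\<close> not containing \<open>p\<close> such that \<open>f S \<in> U\<close> for all
  finite \<open>S \<supseteq> F\<close>. Taking for \<open>U\<close> an open ray shows that \<open>p\<close> is the first point of \<open>X\<close>. For general \<open>U\<close>,
  let \<open>q\<close> be the minimum of \<open>F\<close>; every \<open>x\<close> below \<open>q\<close> equals \<open>f (F \<union> {x})\<close>, so the
  ray below \<open>q\<close> is a neighbourhood of \<open>p\<close> inside \<open>U\<close>, and its boundary is contained in \<open>{q}\<close>.
\<close>

section \<open>Connected pieces and the Vietoris topology\<close>

lemma connectedin_insert_open_part:
  assumes "connected_space X" "openin X L" "openin X R" "L \<inter> R = {}"
    and "x \<in> topspace X" "L \<union> R = topspace X - {x}"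
  shows "connectedin X (insert x L)"
proof -
  \<comment> \<open>With \<open>x\<close> in \<open>A\<close>, the open sets
    \<open>A \<union> R\<close> and \<open>B \<inter> L\<close> would separate \<open>X\<close>
    itself; the other case follows by exchanging \<open>A\<close> and \<open>B\<close>.\<close>
  have no_split: False
    if "openin X A" "openin X B" "insert x L \<subseteq> A \<union> B" "A \<inter> B \<inter> insert x L = {}"
      "x \<in> A" "B \<inter> insert x L \<noteq> {}" for A B
  proof -
    have "openin X (A \<union> R)" "openin X (B \<inter> L)"
      using that assms by auto
    moreover have "topspace X \<subseteq> (A \<union> R) \<union> (B \<inter> L)"
      using that assms(6) by blast
    moreover have "(A \<union> R) \<inter> (B \<inter> L) = {}"
      using that assms(4) by blast
    moreover have "A \<union> R \<noteq> {}" "B \<inter> L \<noteq> {}"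
      using that by auto
    ultimately show False
      using assms(1) unfolding connected_space_def by metis
  qed
  show ?thesis
    unfolding connectedin
  proof (intro conjI notI)
    show "insert x L \<subseteq> topspace X"
      using assms by (auto dest: openin_subset)
  next
    assume "\<exists>E1 E2. openin X E1 \<and> openin X E2 \<and> insert x L \<subseteq> E1 \<union> E2 \<and>
      E1 \<inter> E2 \<inter> insert x L = {} \<and> E1 \<inter> insert x L \<noteq> {} \<and> E2 \<inter> insert x L \<noteq> {}"
    then obtain A B where AB: "openin X A" "openin X B" "insert x L \<subseteq> A \<union> B"
      "A \<inter> B \<inter> insert x L = {}" "A \<inter> insert x L \<noteq> {}" "B \<inter> insert x L \<noteq> {}"
      by auto
    then have "x \<in> A \<or> x \<in> B"
      by auto
    then show False
      using no_split[of A B] no_split[of B A] AB by (auto simp: Int_ac Un_ac)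
  qed
qed

lemma finite_in_hyperspace:
  assumes "t1_space X" "finite S" "S \<subseteq> topspace X" "S \<noteq> {}"
  shows "S \<in> hyperspace X"
  using assms by (simp add: hyperspace_def t1_space_closedin_finite)

text \<open>Allows one point of a finite set to move while the rest stays fixed, so that
  connectedness can control the selected value.\<close>

lemma continuous_map_vietoris_insert:
  assumes "t1_space X" "finite F" "F \<subseteq> topspace X"
  shows "continuous_map X (vietoris X) (\<lambda>x. insert x F)"
  unfolding vietoris_def
proof (rule continuous_on_generated_topo)
  let ?i = "\<lambda>x. insert x F"
  have hyp: "?i x \<in> hyperspace X" if "x \<in> topspace X" for x
    using that assms finite_in_hyperspace[of X "?i x"] by auto
  show "?i ` topspace X \<subseteq> \<Union>{vietoris_basic X \<V> |\<V>. finite \<V> \<and> (\<forall>V\<in>\<V>. openin X V)}"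
    using hyp topspace_vietoris[of X] unfolding vietoris_def topology_generated_by_topspace by auto
  fix W
  assume "W \<in> {vietoris_basic X \<V> |\<V>. finite \<V> \<and> (\<forall>V\<in>\<V>. openin X V)}"
  then obtain \<V> where \<V>: "W = vietoris_basic X \<V>" "finite \<V>" "\<And>V. V \<in> \<V> \<Longrightarrow> openin X V"
    by auto
  show "openin X (?i -` W \<inter> topspace X)"
  proof (cases "F \<subseteq> \<Union>\<V>")
    case True
    \<comment> \<open>Members of the family that meet \<open>F\<close> are met anyway; each of the
      others must contain the moving point. If there are no others, their intersection is the whole
      type, hence the factor \<open>topspace X\<close>.\<close>
    then have "?i -` W \<inter> topspace X
        = \<Union>\<V> \<inter> (topspace X \<inter> \<Inter>{V \<in> \<V>. F \<inter> V = {}})"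
      using hyp by (auto simp: \<V>(1) vietoris_basic_def)
    moreover have "openin X (topspace X \<inter> \<Inter>{V \<in> \<V>. F \<inter> V = {}})"
      using \<V> by (intro openin_Int_Inter) auto
    ultimately show ?thesis
      using \<V> by (auto intro!: openin_Int)
  next
    case False
    then have "?i -` W \<inter> topspace X = {}"
      by (auto simp: \<V>(1) vietoris_basic_def)
    then show ?thesis by simp
  qed
qed

text \<open>An open singleton would be clopen. Hence a point of a nonempty open set can be chosen
  away from a prescribed \<open>p\<close>.\<close>

lemma connected_openin_not_subset_singleton:
  assumes "connected_space X" "t1_space X" "infinite (topspace X)" "openin X V" "V \<noteq> {}"
  shows "\<not> V \<subseteq> {p}"
proof
  assume "V \<subseteq> {p}"
  with \<open>V \<noteq> {}\<close> have "V = {p}" by auto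
  then have "p \<in> topspace X" and "openin X {p}"
    using \<open>openin X V\<close> by (auto dest: openin_subset)
  moreover have "closedin X {p}"
    using assms(2) \<open>p \<in> topspace X\<close> by (simp add: t1_space_closedin_singleton)
  ultimately have "topspace X = {p}"
    using assms(1) unfolding connected_space_clopen_in by blast
  with assms(3) show False by simp
qed

text \<open>For a basic set, one point other than \<open>p\<close> from each member of the family
  suffices: finite supersets meet every member, and the family covers \<open>X\<close>. Avoiding
  \<open>p\<close> later ensures that the least point of \<open>F\<close> differs from
  \<open>f (topspace X)\<close>.\<close>

lemma vietoris_open_topspace_finite:
  assumes "connected_space X" "t1_space X" "infinite (topspace X)"
    and "openin (vietoris X) A" "topspace X \<in> A"
  shows "\<exists>F. finite F \<and> F \<subseteq> topspace X - {p} \<and>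
      (\<forall>S. finite S \<and> S \<subseteq> topspace X \<and> S \<noteq> {} \<and> F \<subseteq> S \<longrightarrow> S \<in> A)"
proof -
  have "generate_topology_on
      {vietoris_basic X \<V> |\<V>. finite \<V> \<and> (\<forall>V\<in>\<V>. openin X V)} A"
    using assms(4) by (simp add: vietoris_def openin_topology_generated_by_iff)
  then show ?thesis
    using assms(5)
  proof (induction rule: generate_topology_on.induct)
    case Empty
    then show ?case by simp
  next
    case (Int A B)
    then have "topspace X \<in> A" "topspace X \<in> B"
      by auto
    obtain F where "finite F" "F \<subseteq> topspace X - {p}"
      "\<And>S. finite S \<and> S \<subseteq> topspace X \<and> S \<noteq> {} \<and> F \<subseteq> S \<Longrightarrow> S \<in> A"
      using Int.IH(1)[OF \<open>topspace X \<in> A\<close>] by metis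
    moreover obtain G where "finite G" "G \<subseteq> topspace X - {p}"
      "\<And>S. finite S \<and> S \<subseteq> topspace X \<and> S \<noteq> {} \<and> G \<subseteq> S \<Longrightarrow> S \<in> B"
      using Int.IH(2)[OF \<open>topspace X \<in> B\<close>] by metis
    ultimately show ?case
      by (intro exI[of _ "F \<union> G"]) (simp add: le_sup_iff)
  next
    case (UN K)
    then show ?case by (meson UnionE UnionI)
  next
    case (Basis B)
    then obtain \<V> where \<V>: "B = vietoris_basic X \<V>" "finite \<V>"
      "\<And>V. V \<in> \<V> \<Longrightarrow> openin X V"
      by auto
    have cover: "topspace X \<subseteq> \<Union>\<V>" and meets: "\<And>V. V \<in> \<V> \<Longrightarrow> topspace X \<inter> V \<noteq> {}"
      using Basis(2) by (auto simp: \<V>(1) vietoris_basic_def)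
    have "\<exists>v. v \<in> V - {p}" if "V \<in> \<V>" for V
      using connected_openin_not_subset_singleton[OF assms(1-3) \<V>(3)[OF that], of p] meets[OF that]
      by auto
    then obtain v where v: "\<And>V. V \<in> \<V> \<Longrightarrow> v V \<in> V - {p}"
      by metis
    show ?case
    proof (intro exI[of _ "v ` \<V>"] conjI allI impI)
      show "finite (v ` \<V>)"
        using \<V>(2) by simp
      show "v ` \<V> \<subseteq> topspace X - {p}"
        using v \<V>(3) openin_subset by blast
      fix S
      assume S: "finite S \<and> S \<subseteq> topspace X \<and> S \<noteq> {} \<and> v ` \<V> \<subseteq> S"
      then have "S \<in> hyperspace X"
        using finite_in_hyperspace assms(2) by blast
      then show "S \<in> B"
        using S cover v unfolding \<V>(1) vietoris_basic_def by blast
    qed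
  qed
qed

section \<open>The linear order given by a continuous selection\<close>

locale continuum_selection =
  fixes X :: "'a topology" and f :: "'a set \<Rightarrow> 'a"
  assumes Hausdorff: "Hausdorff_space X"
    and connected: "connected_space X"
    and selection: "continuous_selection X f"
begin

lemma t1: "t1_space X"
  using Hausdorff by (rule Hausdorff_imp_t1_space)

text \<open>Without \<open>x \<noteq> y\<close>, a point \<open>y\<close> of \<open>X\<close> would
  lie in both \<open>below y\<close> and \<open>above y\<close>, since
  \<open>f {y} = y\<close>.\<close>

definition below :: "'a \<Rightarrow> 'a set" where
  "below y = {x \<in> topspace X. x \<noteq> y \<and> f {x, y} = x}"

definition above :: "'a \<Rightarrow> 'a set" where
  "above y = {x \<in> topspace X. x \<noteq> y \<and> f {x, y} = y}"

lemma selects: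
  assumes "finite S" "S \<subseteq> topspace X" "S \<noteq> {}"
  shows "f S \<in> S"
  using selection finite_in_hyperspace[OF t1 assms]
  by (simp add: continuous_selection_def selection_def)

lemma continuous_map_select_insert:
  assumes "finite F" "F \<subseteq> topspace X"
  shows "continuous_map X X (\<lambda>x. f (insert x F))"
  using continuous_map_compose[OF continuous_map_vietoris_insert[OF t1 assms], of X f] selection
  by (simp add: continuous_selection_def o_def)

lemma below_iff_above: "\<lbrakk>x \<in> topspace X; y \<in> topspace X\<rbrakk> \<Longrightarrow> x \<in> below y \<longleftrightarrow> y \<in> above x"
  by (auto simp: below_def above_def insert_commute)

lemma below_Int_above: "below y \<inter> above y = {}"
  by (auto simp: below_def above_def)

lemma below_Un_above:
  assumes "y \<in> topspace X"
  shows "below y \<union> above y = topspace X - {y}"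
proof -
  have "f {x, y} \<in> {x, y}" if "x \<in> topspace X" for x
    using assms that by (intro selects) auto
  then show ?thesis
    using assms by (auto simp: below_def above_def)
qed

text \<open>Separate \<open>x\<close> from \<open>y\<close> by disjoint open sets \<open>U\<close>
  and \<open>W\<close>. When \<open>x\<close> moves slightly, the selected point of the pair stays
  in \<open>U\<close> (for \<open>below\<close>) or in \<open>W\<close> (for \<open>above\<close>),
  which decides which of the two points it is.\<close>

lemma openin_below_above:
  assumes y: "y \<in> topspace X"
  shows "openin X (below y)" "openin X (above y)"
proof -
  have cont: "openin X {x \<in> topspace X. f {x, y} \<in> U}" if "openin X U" for U
    using continuous_map_select_insert[of "{y}"] y that by (simp add: openin_continuous_map_preimage)
  have sep: "\<exists>U W. openin X U \<and> openin X W \<and> x \<in> U \<and> y \<in> W \<and> U \<inter> W = {}"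
    if "x \<in> topspace X" "x \<noteq> y" for x
    using Hausdorff y that by (auto simp: Hausdorff_space_def disjnt_def)
  have sel: "f {x, y} = x \<or> f {x, y} = y" if "x \<in> topspace X" for x
    using selects[of "{x, y}"] that y by auto
  show "openin X (below y)"
  proof (subst openin_subopen, intro ballI)
    fix x assume x: "x \<in> below y"
    then obtain U W where UW: "openin X U" "x \<in> U" "y \<in> W" "U \<inter> W = {}"
      using sep[of x] by (auto simp: below_def)
    show "\<exists>T. openin X T \<and> x \<in> T \<and> T \<subseteq> below y"
    proof (intro exI conjI)
      show "openin X (U \<inter> {x \<in> topspace X. f {x, y} \<in> U})"
        using UW cont by blast
      show "x \<in> U \<inter> {x \<in> topspace X. f {x, y} \<in> U}"
        using x UW by (simp add: below_def)
      show "U \<inter> {x \<in> topspace X. f {x, y} \<in> U} \<subseteq> below y"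
        using UW sel unfolding below_def by fastforce
    qed
  qed
  show "openin X (above y)"
  proof (subst openin_subopen, intro ballI)
    fix x assume x: "x \<in> above y"
    then obtain U W where UW: "openin X U" "openin X W" "x \<in> U" "y \<in> W" "U \<inter> W = {}"
      using sep[of x] by (auto simp: above_def)
    show "\<exists>T. openin X T \<and> x \<in> T \<and> T \<subseteq> above y"
    proof (intro exI conjI)
      show "openin X (U \<inter> {x \<in> topspace X. f {x, y} \<in> W})"
        using UW cont by blast
      show "x \<in> U \<inter> {x \<in> topspace X. f {x, y} \<in> W}"
        using x UW by (simp add: above_def)
      show "U \<inter> {x \<in> topspace X. f {x, y} \<in> W} \<subseteq> above y"
        using UW sel unfolding above_def by fastforce
    qed
  qed
qed

lemma closedin_insert_below_above:
  assumes y: "y \<in> topspace X"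
  shows "closedin X (insert y (below y))" "closedin X (insert y (above y))"
proof -
  have "insert y (below y) = topspace X - above y" "insert y (above y) = topspace X - below y"
    using below_Un_above[OF y] below_Int_above[of y] y by (auto simp: below_def above_def)
  then show "closedin X (insert y (below y))" "closedin X (insert y (above y))"
    using openin_below_above[OF y] by (auto simp: closedin_def)
qed

lemma connectedin_insert_above:
  assumes y: "y \<in> topspace X"
  shows "connectedin X (insert y (above y))"
proof (rule connectedin_insert_open_part[OF connected openin_below_above(2,1)[OF y] _ y])
  show "above y \<inter> below y = {}" "above y \<union> below y = topspace X - {y}"
    using below_Int_above[of y] below_Un_above[OF y] by auto
qed

text \<open>The closed ray from \<open>y\<close> is connected and misses \<open>x\<close>, so it
  lies in one of the two open rays at \<open>x\<close>; its point \<open>y\<close> lies in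
  \<open>above x\<close>.\<close>

lemma above_trans:
  assumes y: "y \<in> above x" and x: "x \<in> topspace X"
  shows "above y \<subseteq> above x"
proof (rule ccontr)
  have yX: "y \<in> topspace X" and "x \<notin> above y" "x \<noteq> y"
    using y x by (auto simp: above_def insert_commute)
  then have sub: "insert y (above y) \<subseteq> above x \<union> below x"
    using below_Un_above[OF x] by (auto simp: above_def)
  assume "\<not> above y \<subseteq> above x"
  with sub have "below x \<inter> insert y (above y) \<noteq> {}"
    by auto
  then show False
    using connectedin_insert_above[OF yX] openin_below_above[OF x] sub y below_Int_above[of x]
    unfolding connectedin by (metis Int_commute Int_empty_left Int_insert_right_if1 insert_not_empty)
qed

section \<open>Finite sets and their least points\<close>

lemma finite_has_first:
  assumes "finite S" "S \<noteq> {}" "S \<subseteq> topspace X"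
  shows "\<exists>m\<in>S. S \<subseteq> insert m (above m)"
  using assms
proof (induction rule: finite_ne_induct)
  case (singleton x)
  then show ?case by simp
next
  case (insert x F)
  then obtain m where m: "m \<in> F" "F \<subseteq> insert m (above m)" "m \<in> topspace X" "x \<in> topspace X" "x \<noteq> m"
    by auto
  then consider "x \<in> above m" | "m \<in> above x"
    using below_Un_above[of m] below_iff_above[of x m] by blast
  then show ?case
  proof cases
    case 1
    then show ?thesis using m by blast
  next
    case 2
    then show ?thesis using m above_trans[of m x] by blast
  qed
qed

text \<open>
  Moving one point \<open>x\<close> inside \<open>C\<close>, the selected point stays in \<open>{m} \<union> C\<close> and depends continuously
  on \<open>x\<close>, so it cannot jump from \<open>m\<close> into \<open>C\<close>.
\<close>
lemma select_insert_eq: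
  assumes C: "closedin X C" "connectedin X C" and m: "m \<in> topspace X" "m \<notin> C"
    and pair: "\<And>x. x \<in> C \<Longrightarrow> f {m, x} = m"
    and "finite F" "F \<noteq> {}" "F \<subseteq> C"
  shows "f (insert m F) = m"
  using assms(6-8)
proof (induction rule: finite_ne_induct)
  case (singleton x)
  then show ?case using pair by simp
next
  case (insert x F)
  have CX: "C \<subseteq> topspace X"
    using C(1) by (rule closedin_subset)
  define g where "g = (\<lambda>x. f (insert x (insert m F)))"
  have cont: "continuous_map X X g"
    unfolding g_def using insert m CX by (intro continuous_map_select_insert) auto
  have g_in: "g y \<in> insert m C" if "y \<in> C" for y
  proof -
    have "g y \<in> insert y (insert m F)"
      unfolding g_def using insert that m CX by (intro selects) auto
    then show ?thesis
      using insert that by auto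
  qed
  \<comment> \<open>At \<open>z\<close> the moving point merges with a point of \<open>F\<close>, so
    the induction hypothesis supplies one place where the value is \<open>m\<close>.\<close>
  obtain z where z: "z \<in> F"
    using insert by auto
  then have gz: "g z = m"
    using insert by (simp add: g_def insert_absorb insert_commute)
  define A where "A = {x \<in> topspace X. g x \<in> {m}}"
  define B where "B = {x \<in> topspace X. g x \<in> C}"
  have "closedin X {m}"
    using t1 m by (simp add: t1_space_closedin_singleton)
  then have "closedin X A" "closedin X B"
    unfolding A_def B_def using cont C(1) closedin_continuous_map_preimage by blast+
  moreover have "C \<subseteq> A \<union> B" "A \<inter> B \<inter> C = {}" "A \<inter> C \<noteq> {}"
    using g_in CX m gz z insert by (auto simp: A_def B_def)
  ultimately have "B \<inter> C = {}"
    using C(2) unfolding connectedin_closedin by blast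
  then have "g x = m"
    using g_in insert CX by (auto simp: B_def)
  then show ?case
    by (simp add: g_def insert_commute)
qed

lemma select_first:
  assumes "finite F" "F \<subseteq> above m" "m \<in> topspace X"
  shows "f (insert m F) = m"
proof (cases "F = {}")
  case True
  then show ?thesis using selects[of "{m}"] assms by simp
next
  case False
  moreover have "F \<subseteq> topspace X"
    using assms by (auto simp: above_def)
  ultimately obtain w where w: "w \<in> F" "F \<subseteq> insert w (above w)" "w \<in> topspace X"
    using finite_has_first[OF assms(1)] by blast
  \<comment> \<open>The closed ray from the least point \<open>w\<close> of \<open>F\<close> serves
    as the connected set: it contains \<open>F\<close> and, by transitivity, avoids
    \<open>m\<close>.\<close>
  then have sub: "insert w (above w) \<subseteq> above m"
    using above_trans[of w m] assms(2,3) w(1) by blast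
  show ?thesis
  proof (rule select_insert_eq)
    show "m \<notin> insert w (above w)" "\<And>x. x \<in> insert w (above w) \<Longrightarrow> f {m, x} = m"
      using sub by (auto simp: above_def insert_commute)
  qed (use False w assms closedin_insert_below_above connectedin_insert_above in auto)
qed

section \<open>From finite sets to the whole space\<close>

lemma select_topspace_finite:
  assumes "infinite (topspace X)" "openin X U" "f (topspace X) \<in> U"
  obtains F where "finite F" "F \<subseteq> topspace X - {f (topspace X)}"
    "\<And>S. \<lbrakk>finite S; S \<subseteq> topspace X; S \<noteq> {}; F \<subseteq> S\<rbrakk> \<Longrightarrow> f S \<in> U"
proof -
  let ?A = "{S \<in> topspace (vietoris X). f S \<in> U}"
  have "openin (vietoris X) ?A"
    using selection assms(2) unfolding continuous_selection_def
    by (intro openin_continuous_map_preimage) auto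
  moreover have "topspace X \<in> ?A"
    using assms by (auto simp: topspace_vietoris hyperspace_def)
  ultimately have "\<exists>F. finite F \<and> F \<subseteq> topspace X - {f (topspace X)} \<and>
      (\<forall>S. finite S \<and> S \<subseteq> topspace X \<and> S \<noteq> {} \<and> F \<subseteq> S \<longrightarrow> S \<in> ?A)"
    by (rule vietoris_open_topspace_finite[OF connected t1 assms(1)])
  then obtain F where F: "finite F" "F \<subseteq> topspace X - {f (topspace X)}"
    "\<forall>S. finite S \<and> S \<subseteq> topspace X \<and> S \<noteq> {} \<and> F \<subseteq> S \<longrightarrow> S \<in> ?A"
    by (elim exE conjE)
  show ?thesis
    by (rule that[OF F(1,2)]) (use F(3) in simp)
qed

lemma select_topspace_in:
  assumes "infinite (topspace X)"
  shows "f (topspace X) \<in> topspace X"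
proof -
  have "topspace X \<in> hyperspace X"
    using assms by (auto simp: hyperspace_def)
  then show ?thesis
    using selection unfolding continuous_selection_def selection_def by blast
qed

text \<open>If \<open>x\<close> preceded the selected point, \<open>above x\<close> would be a
  neighbourhood of that point. A large finite set containing \<open>x\<close> would then have its
  minimum, which \<open>f\<close> selects, strictly above \<open>x\<close>.\<close>

lemma select_topspace_first:
  assumes "infinite (topspace X)" "x \<in> topspace X" "x \<noteq> f (topspace X)"
  shows "x \<in> above (f (topspace X))"
proof (rule ccontr)
  let ?p = "f (topspace X)"
  assume "x \<notin> above ?p"
  then have "?p \<in> above x"
    using assms below_Un_above[of ?p] below_iff_above[of x ?p] select_topspace_in by blast
  then obtain F where F: "finite F" "F \<subseteq> topspace X - {?p}"
    "\<And>S. \<lbrakk>finite S; S \<subseteq> topspace X; S \<noteq> {}; F \<subseteq> S\<rbrakk> \<Longrightarrow> f S \<in> above x"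
    using select_topspace_finite[OF assms(1) openin_below_above(2)[OF assms(2)]] by metis
  let ?S = "insert x F"
  have fin: "finite ?S" "?S \<subseteq> topspace X" "?S \<noteq> {}"
    using F assms by auto
  then obtain m where m: "m \<in> ?S" "?S \<subseteq> insert m (above m)" "m \<in> topspace X"
    using finite_has_first[OF fin(1,3,2)] by blast
  have "f (insert m (?S - {m})) = m"
    using m fin by (intro select_first) auto
  then have "f ?S = m"
    using m(1) by (simp add: insert_absorb)
  then have "m \<in> above x"
    using F(3)[OF fin] by auto
  moreover have "x \<in> insert m (above m)"
    using m by auto
  ultimately show False
    by (auto simp: above_def insert_commute)
qed

lemma select_topspace_small_frontier:
  assumes "infinite (topspace X)" "openin X U" "f (topspace X) \<in> U"
  obtains V q where "openin X V" "f (topspace X) \<in> V" "V \<subseteq> U" "X frontier_of V \<subseteq> {q}"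
proof -
  let ?p = "f (topspace X)"
  obtain F where F: "finite F" "F \<subseteq> topspace X - {?p}"
    "\<And>S. \<lbrakk>finite S; S \<subseteq> topspace X; S \<noteq> {}; F \<subseteq> S\<rbrakk> \<Longrightarrow> f S \<in> U"
    using select_topspace_finite[OF assms] by metis
  show thesis
  proof (cases "F = {}")
    \<comment> \<open>Now \<open>f\<close> maps every one-point set into \<open>U\<close>, so
      \<open>U\<close> is all of \<open>X\<close> and has empty frontier; any \<open>q\<close> will
      do.\<close>
    case True
    have "x \<in> U" if "x \<in> topspace X" for x
      using F(3)[of "{x}"] selects[of "{x}"] that True by simp
    then have "U = topspace X"
      using assms(2) by (auto dest: openin_subset)
    then show thesis
      using that[of U] assms by simp
  next
    case False
    then obtain q where q: "q \<in> F" "F \<subseteq> insert q (above q)" "q \<in> topspace X" "q \<noteq> ?p"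
      using F finite_has_first[of F] by blast
    show thesis
    proof (rule that)
      show "openin X (below q)"
        using openin_below_above(1) q by blast
      show "?p \<in> below q"
        using select_topspace_first[OF assms(1)] q below_iff_above select_topspace_in[OF assms(1)]
        by blast
      show "below q \<subseteq> U"
      proof
        fix x assume x: "x \<in> below q"
        then have "x \<in> topspace X" "q \<in> above x"
          using q below_iff_above[of x q] by (auto simp: below_def)
        then have "f (insert x F) = x"
          using q F(1) above_trans[of q x] by (intro select_first) auto
        then show "x \<in> U"
          using F(3)[of "insert x F"] F(1,2) \<open>x \<in> topspace X\<close> by auto
      qed
      \<comment> \<open>The ray is open and adding \<open>q\<close> makes it closed, so only
        \<open>q\<close> can be a frontier point.\<close>
      have "X closure_of below q \<subseteq> insert q (below q)"
        by (intro closure_of_minimal closedin_insert_below_above q) auto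
      then show "X frontier_of below q \<subseteq> {q}"
        using openin_below_above(1)[OF q(3)] by (auto simp: frontier_of_def interior_of_openin)
    qed
  qed
qed

section \<open>The order of the selected point\<close>

lemma order_bound_select_topspace:
  assumes "infinite (topspace X)"
  shows "order_bound (f (topspace X)) X |{a}|"
  unfolding order_bound_def
proof (intro allI impI)
  fix U assume "openin X U \<and> f (topspace X) \<in> U"
  then obtain V q where V: "openin X V" "f (topspace X) \<in> V" "V \<subseteq> U" "X frontier_of V \<subseteq> {q}"
    using select_topspace_small_frontier[OF assms] by metis
  have "|X frontier_of V| \<le>o |{q}|"
    using V(4) by (rule card_of_mono1)
  \<comment> \<open>The point \<open>q\<close> varies with \<open>U\<close>, but the bound must not;
    any fixed singleton represents the cardinal one.\<close>
  also have "|{q}| \<le>o |{a}|"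
    by (rule surj_imp_ordLeq[of _ "\<lambda>_. q"]) auto
  finally show "\<exists>V. openin X V \<and> f (topspace X) \<in> V \<and> V \<subseteq> U \<and> |X frontier_of V| \<le>o |{a}|"
    using V by blast
qed

end

text \<open>Inside the complement of a point \<open>q\<close> other than \<open>p\<close>, every
  open \<open>V\<close> around \<open>p\<close> is nonempty and proper, so connectedness gives it a
  frontier point.\<close>

lemma singleton_ordLeq_order_bound:
  assumes "t1_space X" "connected_space X" "infinite (topspace X)" "p \<in> topspace X"
    and r: "order_bound p X r"
  shows "|{a}| \<le>o r"
proof -
  have "\<not> topspace X \<subseteq> {p}"
    using assms(3) finite_subset by blast
  then obtain q where q: "q \<in> topspace X" "q \<noteq> p"
    by auto
  have "openin X (topspace X - {q})"
    using assms(1) q by (intro openin_diff) (auto simp: t1_space_closedin_singleton)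
  then obtain V where V: "openin X V" "p \<in> V" "V \<subseteq> topspace X - {q}" "|X frontier_of V| \<le>o r"
    using r assms(4) q unfolding order_bound_def by (metis DiffI singletonD)
  have "X frontier_of V \<noteq> {}"
    using connected_space_eq_frontier_eq_empty[of X] assms(2) V q openin_subset by blast
  then obtain b where "b \<in> X frontier_of V"
    by auto
  then have "|{a}| \<le>o |X frontier_of V|"
    by (intro card_of_ordLeqI[where f = "\<lambda>_. b"]) auto
  then show ?thesis
    using V(4) by (rule ordLeq_transitive)
qed

theorem proposition2p7:
  fixes X :: "'a topology"
  assumes "Hausdorff_space X"
    and "connected_space X"
    and "infinite (topspace X)"
  shows "O_cs X \<subseteq> endpoints X"
proof
  fix p assume "p \<in> O_cs X"
  then obtain f where f: "continuous_selection X f" and p: "p = f (topspace X)"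
    by (auto simp: O_cs_def)
  interpret continuum_selection X f
    using assms f by unfold_locales
  have pX: "p \<in> topspace X"
    using select_topspace_in assms(3) p by simp
  \<comment> \<open>Minimality of \<open>point_order\<close> gives the upper bound; that it is
    itself an \<open>order_bound\<close> gives the lower one.\<close>
  have "point_order p X \<le>o |{p}|"
    unfolding p
    by (intro point_order_least(3) card_of_Card_order order_bound_select_topspace assms(3))
  moreover have "|{p}| \<le>o point_order p X"
    using singleton_ordLeq_order_bound[OF t1 assms(2,3) pX point_order_least(2)] .
  ultimately have "point_order p X =o |{p}|"
    by (simp add: ordIso_iff_ordLeq)
  also have "|{p}| =o BNF_Cardinal_Arithmetic.cone"
    unfolding BNF_Cardinal_Arithmetic.cone_def by (rule card_of_ordIsoI[of "\<lambda>_. ()"]) (auto simp: bij_betw_def)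
  finally show "p \<in> endpoints X"
    using pX by (simp add: endpoints_def)
qed

end
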